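(* Let $T: \mathbb{R}^d \rightarrow \mathbb{R}^d$ be an orthogonal (linear) transformation, i.e. $T^{\top} T=I$, where $I$ is the identity matrix. For any $A, B \in \mathcal{K}^d_{kc}$, $$T\left(A \ominus_e B\right)=T A \ominus_e T B,$$ where $T(A \ominus_e B)$ means the collection of $TX$ for all $X \in A \ominus_e B$.
   Context: $\mathcal{K}^d_{kc}$ is the set of all nonempty compact convex subsets of Euclidean space $\mathbb{R}^d$ (with norm $\|\cdot\|$). Minkowski sum: $A\oplus B=\{a+b: a\in A, b\in B\}$; $TA=\{Ta: a\in A\}$. Hausdorff distance: $d_H(A,B)=\max\{\sup_{a\in A}\inf_{b\in B}\|a-b\|,\ \sup_{b\in B}\inf_{a\in A}\|a-b\|\}$. The extended set difference of $A,B\in\mathcal{K}^d_{kc}$ is the collection of minimizers $A\ominus_e B=\{X\in\mathcal{K}^d_{kc}: d_H(A,B\oplus X)=\inf_{Y\in\mathcal{K}^d_{kc}} d_H(A,B\oplus Y)\}$. *)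

theory Defs
  imports "HOL-Analysis.Analysis"
begin

text \<open>
  The Minkowski sum is the pointwise addition of sets from
  \<^theory>\<open>HOL-Library.Set_Algebras\<close>, written \<open>A + B\<close>.
\<close>

definition compact_convex_sets :: "'a::euclidean_space set set"  (\<open>\<K>\<^sub>k\<^sub>c\<close>)
  where "\<K>\<^sub>k\<^sub>c = {A. A \<noteq> {} \<and> compact A \<and> convex A}"

text \<open>
  The suprema and infima are taken in the reals, so the value is meaningful only
  for nonempty bounded sets.
\<close>

definition hausdorff_dist :: "'a::real_normed_vector set \<Rightarrow> 'a set \<Rightarrow> real"
  where "hausdorff_dist A B =
    max (SUP a\<in>A. INF b\<in>B. norm (a - b)) (SUP b\<in>B. INF a\<in>A. norm (a - b))"

definition ext_set_diff :: "'a::euclidean_space set \<Rightarrow> 'a set \<Rightarrow> 'a set set"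
    (infixl \<open>\<ominus>\<^sub>e\<close> 65)
  where "A \<ominus>\<^sub>e B =
    {X \<in> \<K>\<^sub>k\<^sub>c. hausdorff_dist A (B + X) = (INF Y\<in>\<K>\<^sub>k\<^sub>c. hausdorff_dist A (B + Y))}"

end

theory Submission
  imports Defs
begin

text \<open>
  An orthogonal transformation \<open>T\<close> is a linear isometry of the whole space. Linearity gives
  \<open>T (B + X) = T B + T X\<close>, and isometry makes the Hausdorff distance invariant, so the
  objective \<open>X \<mapsto> d(A, B + X)\<close> takes at \<open>X\<close> the value that \<open>X \<mapsto> d(T A, T B + X)\<close>
  takes at \<open>T X\<close>. Since \<open>X \<mapsto> T X\<close> maps \<open>\<K>\<^sub>k\<^sub>c\<close> onto itself, the two minimization
  problems are one problem in two parametrizations: they have the same infimum, and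
  \<open>X \<mapsto> T X\<close> carries the minimizers of the first onto those of the second.
\<close>

lemma hausdorff_dist_linear_isometry_image:
  assumes "linear T" and "\<And>x. norm (T x) = norm x"
  shows "hausdorff_dist (T ` A) (T ` B) = hausdorff_dist A B"
proof -
  have "norm (T a - T b) = norm (a - b)" for a b
    using assms by (metis linear_diff)
  then show ?thesis
    by (simp add: hausdorff_dist_def image_image)
qed

lemma linear_image_set_plus:
  assumes "linear T"
  shows "T ` (A + B) = T ` A + T ` B"
  by (force simp: set_plus_def image_iff linear_add[OF assms])

lemma linear_image_compact_convex_sets:
  fixes T :: "'a::euclidean_space \<Rightarrow> 'b::euclidean_space"
  assumes "linear T" and "A \<in> \<K>\<^sub>k\<^sub>c"
  shows "T ` A \<in> \<K>\<^sub>k\<^sub>c"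
  using assms
  by (auto simp: compact_convex_sets_def simp flip: linear_conv_bounded_linear
      intro!: compact_continuous_image convex_linear_image linear_continuous_on)

text \<open>
  A set in \<open>\<K>\<^sub>k\<^sub>c\<close> is the image of its preimage, and that preimage lies in \<open>\<K>\<^sub>k\<^sub>c\<close>
  because the inverse of an orthogonal transformation is again linear.
\<close>

lemma orthogonal_transformation_image_compact_convex_sets:
  fixes T :: "'a::euclidean_space \<Rightarrow> 'a"
  assumes T: "orthogonal_transformation T"
  shows "(`) T ` \<K>\<^sub>k\<^sub>c = \<K>\<^sub>k\<^sub>c"
proof
  show "(`) T ` \<K>\<^sub>k\<^sub>c \<subseteq> \<K>\<^sub>k\<^sub>c"
    using linear_image_compact_convex_sets orthogonal_transformation_linear[OF T] by blast
  show "\<K>\<^sub>k\<^sub>c \<subseteq> (`) T ` \<K>\<^sub>k\<^sub>c"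
  proof
    fix X :: "'a set" assume X: "X \<in> \<K>\<^sub>k\<^sub>c"
    have "inv T ` X \<in> \<K>\<^sub>k\<^sub>c"
      using X T linear_image_compact_convex_sets orthogonal_transformation_inv
        orthogonal_transformation_linear by blast
    moreover have "X = T ` (inv T ` X)"
      using image_f_inv_f[OF orthogonal_transformation_surj[OF T]] by metis
    ultimately show "X \<in> (`) T ` \<K>\<^sub>k\<^sub>c"
      by blast
  qed
qed

theorem proposition4:
  fixes T :: "real ^ 'd \<Rightarrow> real ^ 'd" and A B :: "(real ^ 'd) set"
  assumes "linear T"
    and "transpose (matrix T) ** matrix T = mat 1"
    and "A \<in> \<K>\<^sub>k\<^sub>c" and "B \<in> \<K>\<^sub>k\<^sub>c"
  shows "(\<lambda>X. T ` X) ` (A \<ominus>\<^sub>e B) = (T ` A) \<ominus>\<^sub>e (T ` B)"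
proof -
  have T: "orthogonal_transformation T"
    using assms by (simp add: orthogonal_transformation_matrix orthogonal_matrix)
  note onto = orthogonal_transformation_image_compact_convex_sets[OF T]
  have objective: "hausdorff_dist (T ` A) (T ` B + T ` X) = hausdorff_dist A (B + X)" for X
    using hausdorff_dist_linear_isometry_image[OF \<open>linear T\<close>]
      orthogonal_transformation_norm[OF T]
    by (simp flip: linear_image_set_plus[OF \<open>linear T\<close>])
  have "(INF Y\<in>\<K>\<^sub>k\<^sub>c. hausdorff_dist (T ` A) (T ` B + Y)) =
      (INF Y\<in>(`) T ` \<K>\<^sub>k\<^sub>c. hausdorff_dist (T ` A) (T ` B + Y))"
    by (simp only: onto)
  also have "\<dots> = (INF Y\<in>\<K>\<^sub>k\<^sub>c. hausdorff_dist A (B + Y))"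
    by (simp only: image_image objective)
  finally have infimum: "(INF Y\<in>\<K>\<^sub>k\<^sub>c. hausdorff_dist (T ` A) (T ` B + Y)) =
      (INF Y\<in>\<K>\<^sub>k\<^sub>c. hausdorff_dist A (B + Y))" .
  show ?thesis
  proof (intro equalityI subsetI)
    fix Z assume "Z \<in> (\<lambda>X. T ` X) ` (A \<ominus>\<^sub>e B)"
    then show "Z \<in> (T ` A) \<ominus>\<^sub>e (T ` B)"
      using onto by (auto simp: ext_set_diff_def infimum objective)
  next
    fix Z assume Z: "Z \<in> (T ` A) \<ominus>\<^sub>e (T ` B)"
    then obtain X where "X \<in> \<K>\<^sub>k\<^sub>c" and "Z = T ` X"
      using onto unfolding ext_set_diff_def by blast
    with Z show "Z \<in> (\<lambda>X. T ` X) ` (A \<ominus>\<^sub>e B)"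
      by (auto simp: ext_set_diff_def infimum objective)
  qed
qed

end
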